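(* Let $\{A_e+\bm v_e\}_{e\in\mathcal E}$ be a GLS IFS with the additional assumption that $h_e\ne h_{e'}$ whenever $e\ne e'$. Then for each $x\in[0,1]$ there are uncountably many different digit sequences $(s_m,K_m,t_m)_{m\ge1}\in\mathcal A^{\mathbb N}$ with \[x=\sum_{m\ge1}(-1)^{\sum_{i=1}^{m-1}s_i}\,\frac{t_m}{\prod_{i=1}^{m-1}K_i}.\]
   Context: **GLS IFS.** A GLS IFS is given by: an integer $J\ge2$; a probability vector $(p_j)_{0\le j<J}$ with all $p_j>0$; and for each $0\le j<J$ an integer $B_j\ge2$, a partition $0=r_{(j,0)}<r_{(j,1)}<\cdots<r_{(j,B_j)}=1$ and a vector $(\varepsilon_{(j,k)})_{0\le k<B_j}\in\{0,1\}^{B_j}$. Set $\mathcal E=\{(j,k):0\le j<J,\ 0\le k<B_j\}$, $q_{(j,k)}=r_{(j,k+1)}-r_{(j,k)}$, and \[A_{(j,k)}=\begin{bmatrix}(-1)^{\varepsilon_{(j,k)}}q_{(j,k)}&0\\0&p_j\end{bmatrix},\qquad \bm v_{(j,k)}=\begin{bmatrix}r_{(j,k)}+\varepsilon_{(j,k)}q_{(j,k)}\\ \sum_{i=0}^{j-1}p_i\end{bmatrix}.\] The GLS IFS is the IFS $\{A_e+\bm v_e\}_{e\in\mathcal E}$ on $\mathbb R^2$. For $e\in\mathcal E$, $h_e:[0,1]\to[0,1]$ is the first-coordinate map $h_e(x)=r_e+q_e(\varepsilon_e+(-1)^{\varepsilon_e}x)$. The GLS digit set is $\mathcal A=\{(\varepsilon_e,\,q_e^{-1},\,r_e+\varepsilon_eq_e):e\in\mathcal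 E\}$; elements of $\mathcal A$ are written $(s,K,t)$. Empty sums are $0$ and empty products are $1$. *)

theory Defs
  imports "HOL-Analysis.Analysis"
begin

text \<open>
  The data of a GLS IFS. Only the values \<open>p j\<close>, \<open>B j\<close> for \<open>j < J\<close>, the values \<open>r (j, k)\<close> for
  \<open>k \<le> B j\<close> and the values \<open>eps (j, k)\<close> for \<open>k < B j\<close> are relevant.
\<close>

record gls_data =
  gls_J :: nat
  gls_p :: "nat \<Rightarrow> real"
  gls_B :: "nat \<Rightarrow> nat"
  gls_r :: "nat \<times> nat \<Rightarrow> real"
  gls_eps :: "nat \<times> nat \<Rightarrow> nat"

definition gls_valid :: "gls_data \<Rightarrow> bool" where
  "gls_valid G \<longleftrightarrow>
     gls_J G \<ge> 2 \<and>
     (\<forall>j<gls_J G. gls_p G j > 0) \<and>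
     (\<Sum>j<gls_J G. gls_p G j) = 1 \<and>
     (\<forall>j<gls_J G.
        gls_B G j \<ge> 2 \<and>
        gls_r G (j, 0) = 0 \<and>
        (\<forall>k<gls_B G j. gls_r G (j, k) < gls_r G (j, Suc k)) \<and>
        gls_r G (j, gls_B G j) = 1 \<and>
        (\<forall>k<gls_B G j. gls_eps G (j, k) \<in> {0, 1}))"

definition gls_edges :: "gls_data \<Rightarrow> (nat \<times> nat) set" where
  "gls_edges G = {(j, k). j < gls_J G \<and> k < gls_B G j}"

definition gls_q :: "gls_data \<Rightarrow> nat \<times> nat \<Rightarrow> real" where
  "gls_q G e = gls_r G (fst e, Suc (snd e)) - gls_r G e"

definition gls_A :: "gls_data \<Rightarrow> nat \<times> nat \<Rightarrow> real ^ 2 ^ 2" where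
  "gls_A G e = vector [vector [(-1) ^ gls_eps G e * gls_q G e, 0],
                       vector [0, gls_p G (fst e)]]"

definition gls_v :: "gls_data \<Rightarrow> nat \<times> nat \<Rightarrow> real ^ 2" where
  "gls_v G e = vector [gls_r G e + real (gls_eps G e) * gls_q G e, \<Sum>i<fst e. gls_p G i]"

text \<open>\<open>F\<close> is the GLS IFS on the plane, indexed by \<open>gls_edges G\<close>, that is given by the data \<open>G\<close>.\<close>

definition is_gls_ifs :: "gls_data \<Rightarrow> (nat \<times> nat \<Rightarrow> real ^ 2 \<Rightarrow> real ^ 2) \<Rightarrow> bool" where
  "is_gls_ifs G F \<longleftrightarrow>
     gls_valid G \<and> (\<forall>e\<in>gls_edges G. F e = (\<lambda>z. gls_A G e *v z + gls_v G e))"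

text \<open>Restricted to the unit interval, so that equality of these maps is equality on \<open>[0, 1]\<close>.\<close>

definition gls_h :: "gls_data \<Rightarrow> nat \<times> nat \<Rightarrow> real \<Rightarrow> real" where
  "gls_h G e = (\<lambda>x\<in>{0..1}.
     gls_r G e + gls_q G e * (real (gls_eps G e) + (-1) ^ gls_eps G e * x))"

lemma gls_ifs_first_coordinate:
  assumes "is_gls_ifs G F" "e \<in> gls_edges G" "z $ 1 \<in> {0..1}"
  shows "F e z $ 1 = gls_h G e (z $ 1)"
  using assms
  by (simp add: is_gls_ifs_def gls_h_def gls_A_def gls_v_def
      matrix_vector_mult_def sum_2 vector_2 algebra_simps)

definition gls_digits :: "gls_data \<Rightarrow> (nat \<times> real \<times> real) set" where
  "gls_digits G =
     (\<lambda>e. (gls_eps G e, inverse (gls_q G e), gls_r G e + real (gls_eps G e) * gls_q G e))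
       ` gls_edges G"

abbreviation digit_s :: "nat \<times> real \<times> real \<Rightarrow> nat" where "digit_s d \<equiv> fst d"
abbreviation digit_K :: "nat \<times> real \<times> real \<Rightarrow> real" where "digit_K d \<equiv> fst (snd d)"
abbreviation digit_t :: "nat \<times> real \<times> real \<Rightarrow> real" where "digit_t d \<equiv> snd (snd d)"

text \<open>
  Digit sequences are indexed from 0: \<open>\<omega> m\<close> is the digit \<open>(s, K, t)\<close> with index \<open>m + 1\<close>.
\<close>

definition gls_expansion :: "(nat \<Rightarrow> nat \<times> real \<times> real) \<Rightarrow> real \<Rightarrow> bool" where
  "gls_expansion \<omega> x \<longleftrightarrow>
     (\<lambda>m. (-1) ^ (\<Sum>i<m. digit_s (\<omega> i)) * (digit_t (\<omega> m) / (\<Prod>i<m. digit_K (\<omega> i)))) sums x"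

end

theory Submission
  imports Defs
begin

text \<open>
  Reading the digit \<open>(s, K, t)\<close> as the similarity \<open>y \<mapsto> t + (-1)^s y / K\<close>, the series of a digit
  sequence is the formal composition of these maps, so a sequence expands \<open>x\<close> as soon as \<open>x\<close> can be
  pulled back along all its digits without leaving \<open>[0, 1]\<close>: the error after \<open>n\<close> digits is, up to
  sign, the pulled-back point divided by \<open>K\<^sub>1 \<cdots> K\<^sub>n\<close>, and it vanishes in the limit because the
  finitely many values of \<open>K\<close> all exceed \<open>1\<close> (\<open>gls_expansion_if_orbit_in_unit\<close>).

  The maps \<open>h_e\<close> with \<open>e\<close> in one fixed row \<open>j\<close> have images that cover \<open>[0, 1]\<close>, and there are at least
  two rows. The maps of different edges are different, hence so are their digits. At every point of
  \<open>[0, 1]\<close> there are therefore two different digits along which it can be pulled back, one from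
  row 0 and one from row 1 (\<open>two_admissible_digits\<close>). Making such a binary choice at each step
  injects the binary sequences into the expansions of \<open>x\<close> (\<open>uncountable_itineraries\<close>).
\<close>

section \<open>Itineraries in a branching system\<close>

primrec orbit :: "('d \<Rightarrow> 'a \<Rightarrow> 'a) \<Rightarrow> (nat \<Rightarrow> 'd) \<Rightarrow> 'a \<Rightarrow> nat \<Rightarrow> 'a" where
  "orbit T \<omega> x 0 = x"
| "orbit T \<omega> x (Suc m) = T (\<omega> m) (orbit T \<omega> x m)"

lemma uncountable_binary_sequences: "uncountable (UNIV :: (nat \<Rightarrow> bool) set)"
proof
  assume "countable (UNIV :: (nat \<Rightarrow> bool) set)"
  then obtain f :: "nat \<Rightarrow> nat \<Rightarrow> bool" where "range f = UNIV"
    by (metis UNIV_not_empty uncountable_def)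
  then obtain n where "f n = (\<lambda>m. \<not> f m m)"
    by (metis UNIV_I imageE)
  then have "f n n = (\<not> f n n)"
    by (rule fun_cong)
  then show False
    by simp
qed

text \<open>
  A binary sequence steers the orbit of \<open>x\<close> through \<open>S\<close>. It can be recovered from the digits used:
  the digits determine the orbit, and at each point of the orbit the two digits on offer differ.
\<close>

lemma uncountable_itineraries:
  fixes T :: "'d \<Rightarrow> 'a \<Rightarrow> 'a"
  assumes branch: "\<And>y. y \<in> S \<Longrightarrow> \<exists>d\<in>D. \<exists>d'\<in>D. d \<noteq> d' \<and> T d y \<in> S \<and> T d' y \<in> S"
    and "x \<in> S"
  shows "uncountable {\<omega>. \<forall>m. \<omega> m \<in> D \<and> orbit T \<omega> x m \<in> S}"
proof -
  have "\<exists>d d'. y \<in> S \<longrightarrow> d \<in> D \<and> d' \<in> D \<and> d \<noteq> d' \<and> T d y \<in> S \<and> T d' y \<in> S" for y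
    using branch by blast
  then obtain d0 d1 where d: "\<And>y. y \<in> S \<Longrightarrow>
      d0 y \<in> D \<and> d1 y \<in> D \<and> d0 y \<noteq> d1 y \<and> T (d0 y) y \<in> S \<and> T (d1 y) y \<in> S"
    by metis
  define c where "c b y = (if b then d1 y else d0 y)" for b y
  define pt where "pt b = rec_nat x (\<lambda>m y. T (c (b m) y) y)" for b
  define word where "word b m = c (b m) (pt b m)" for b m
  have pt_in: "pt b m \<in> S" for b m
    by (induction m) (use \<open>x \<in> S\<close> d in \<open>auto simp: pt_def c_def\<close>)
  have orbit_word: "orbit T (word b) x m = pt b m" for b m
    by (induction m) (auto simp: pt_def word_def)
  have "inj word"
  proof (rule injI, rule ext)
    fix b b' m
    assume eq: "word b = word b'"
    then have "pt b m = pt b' m"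
      by (metis orbit_word)
    moreover have "c (b m) (pt b m) = c (b' m) (pt b' m)"
      using fun_cong[OF eq, of m] by (simp add: word_def)
    ultimately show "b m = b' m"
      using d[OF pt_in[of b m]] by (auto simp: c_def split: if_splits)
  qed
  moreover have "word b m \<in> D" for b m
    using d[OF pt_in[of b m]] by (simp add: word_def c_def)
  then have "range word \<subseteq> {\<omega>. \<forall>m. \<omega> m \<in> D \<and> orbit T \<omega> x m \<in> S}"
    by (auto simp: orbit_word pt_in)
  ultimately show ?thesis
    using uncountable_binary_sequences countable_image_inj_on countable_subset by blast
qed

section \<open>Expansions from bounded orbits\<close>

text \<open>The inverse of the map \<open>y \<mapsto> t + (-1)^s y / K\<close> that belongs to the digit \<open>(s, K, t)\<close>.\<close>

definition pull_back :: "nat \<times> real \<times> real \<Rightarrow> real \<Rightarrow> real" where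
  "pull_back d y = (-1) ^ digit_s d * digit_K d * (y - digit_t d)"

lemma eq_digit_map_pull_back:
  assumes "digit_K d \<noteq> 0"
  shows "y = digit_t d + (-1) ^ digit_s d * pull_back d y / digit_K d"
proof -
  have "(-1 :: real) ^ digit_s d * ((-1) ^ digit_s d * z) = z" for z
    by (simp flip: mult.assoc power_mult_distrib)
  then show ?thesis
    using assms by (simp add: pull_back_def mult.assoc)
qed

text \<open>
  Resolving one further digit of the orbit point turns the identity for \<open>n\<close> digits into the one
  for \<open>n + 1\<close>; the orbit thus carries the exact remainder of the series.
\<close>

lemma expansion_with_remainder:
  assumes "\<And>m. digit_K (\<omega> m) \<noteq> 0"
  shows "x = (\<Sum>m<n. (-1) ^ (\<Sum>i<m. digit_s (\<omega> i)) * (digit_t (\<omega> m) / (\<Prod>i<m. digit_K (\<omega> i))))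
    + (-1) ^ (\<Sum>i<n. digit_s (\<omega> i)) * (orbit pull_back \<omega> x n / (\<Prod>i<n. digit_K (\<omega> i)))"
proof (induction n)
  case 0
  show ?case by simp
next
  case (Suc n)
  let ?y = "orbit pull_back \<omega> x n" and ?P = "\<Prod>i<n. digit_K (\<omega> i)"
  have "?y / ?P = digit_t (\<omega> n) / ?P
      + (-1) ^ digit_s (\<omega> n) * (pull_back (\<omega> n) ?y / (?P * digit_K (\<omega> n)))"
    by (subst eq_digit_map_pull_back[OF assms[of n], of ?y])
      (simp add: add_divide_distrib mult.commute)
  with Suc.IH show ?case
    by (simp add: power_add algebra_simps)
qed

lemma gls_expansion_if_orbit_in_unit:
  assumes "c > 1" and K: "\<And>m. digit_K (\<omega> m) \<ge> c"
    and orb: "\<And>m. orbit pull_back \<omega> x m \<in> {0..1}"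
  shows "gls_expansion \<omega> x"
proof -
  define R where
    "R n = (-1) ^ (\<Sum>i<n. digit_s (\<omega> i)) * (orbit pull_back \<omega> x n / (\<Prod>i<n. digit_K (\<omega> i)))" for n
  have prod_ge: "c ^ n \<le> (\<Prod>i<n. digit_K (\<omega> i))" for n
    using prod_mono[of "{..<n}" "\<lambda>_. c" "\<lambda>i. digit_K (\<omega> i)"] K \<open>c > 1\<close> by simp
  have bound: "norm (R n) \<le> inverse c ^ n" for n
  proof -
    have "0 < c ^ n"
      using \<open>c > 1\<close> by simp
    have "norm (R n) = orbit pull_back \<omega> x n / (\<Prod>i<n. digit_K (\<omega> i))"
      using orb[of n] \<open>0 < c ^ n\<close> prod_ge[of n] unfolding R_def
      by (simp add: abs_mult power_abs)
    also have "\<dots> \<le> 1 / c ^ n"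
      using orb[of n] \<open>0 < c ^ n\<close> prod_ge[of n] by (intro frac_le) auto
    finally show ?thesis
      by (simp add: field_simps)
  qed
  have "(\<lambda>n. inverse c ^ n) \<longlonglongrightarrow> 0"
    using \<open>c > 1\<close> by (intro LIMSEQ_realpow_zero) (auto simp: field_simps)
  then have "R \<longlonglongrightarrow> 0"
    by (rule Lim_null_comparison[OF always_eventually, rotated]) (use bound in blast)
  then have "(\<lambda>n. x - R n) \<longlonglongrightarrow> x"
    using tendsto_diff[OF tendsto_const] by fastforce
  moreover have "x - R n =
      (\<Sum>m<n. (-1) ^ (\<Sum>i<m. digit_s (\<omega> i)) * (digit_t (\<omega> m) / (\<Prod>i<m. digit_K (\<omega> i))))" for n
  proof -
    have "digit_K (\<omega> m) \<noteq> 0" for m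
      using K[of m] \<open>c > 1\<close> by auto
    from expansion_with_remainder[of \<omega> x n, OF this] show ?thesis
      unfolding R_def by linarith
  qed
  ultimately show ?thesis
    by (simp add: gls_expansion_def sums_def)
qed

section \<open>The digits of a GLS IFS\<close>

definition digit_of :: "gls_data \<Rightarrow> nat \<times> nat \<Rightarrow> nat \<times> real \<times> real" where
  "digit_of G e = (gls_eps G e, inverse (gls_q G e), gls_r G e + real (gls_eps G e) * gls_q G e)"

lemma gls_digits_eq: "gls_digits G = digit_of G ` gls_edges G"
  by (simp add: gls_digits_def digit_of_def)

lemma finite_gls_edges: "finite (gls_edges G)"
proof -
  have "gls_edges G = Sigma {..<gls_J G} (\<lambda>j. {..<gls_B G j})"
    by (auto simp: gls_edges_def)
  then show ?thesis
    by simp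
qed

lemma partition_increasing:
  fixes r :: "nat \<Rightarrow> real"
  assumes "\<And>k. k < n \<Longrightarrow> r k < r (Suc k)" and "k < l" and "l \<le> n"
  shows "r k < r l"
  using \<open>k < l\<close> \<open>l \<le> n\<close>
proof (induction l)
  case (Suc l)
  then show ?case
    using assms(1)[of l] by (cases "k = l") auto
qed simp

lemma partition_cover:
  fixes r :: "nat \<Rightarrow> real"
  assumes "0 < n" and "y \<in> {r 0..r n}"
  shows "\<exists>k<n. y \<in> {r k..r (Suc k)}"
  using assms
proof (induction n)
  case (Suc n)
  show ?case
  proof (cases "0 < n \<and> y \<le> r n")
    case True
    then show ?thesis
      using Suc by (auto intro: less_SucI)
  next
    case False
    then show ?thesis
      using Suc.prems by (intro exI[of _ n]) auto
  qed
qed simp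

lemma gls_q_pos:
  assumes "gls_valid G" "e \<in> gls_edges G"
  shows "0 < gls_q G e"
  using assms by (auto simp: gls_valid_def gls_edges_def gls_q_def)

text \<open>A row has at least two intervals, so each of them misses a neighbourhood of \<open>0\<close> or of \<open>1\<close>.\<close>

lemma gls_q_less_1:
  assumes "gls_valid G" "e \<in> gls_edges G"
  shows "gls_q G e < 1"
proof -
  obtain j k where e: "e = (j, k)" "j < gls_J G" "k < gls_B G j"
    using assms(2) by (auto simp: gls_edges_def)
  define r where "r k = gls_r G (j, k)" for k
  have B: "gls_B G j \<ge> 2" and r: "r 0 = 0" "r (gls_B G j) = 1"
    and step: "\<And>k. k < gls_B G j \<Longrightarrow> r k < r (Suc k)"
    using assms(1) e by (auto simp: gls_valid_def r_def)
  note mono = partition_increasing[of "gls_B G j" r, OF step]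
  have "r (Suc k) - r k < 1"
  proof (cases "k = 0")
    case True
    then show ?thesis
      using mono[of 1 "gls_B G j"] B r by simp
  next
    case False
    then have "0 < r k"
      using mono[of 0 k] e r by simp
    moreover have "r (Suc k) \<le> 1"
      using mono[of "Suc k" "gls_B G j"] e r by (cases "Suc k = gls_B G j") auto
    ultimately show ?thesis
      by simp
  qed
  then show ?thesis
    by (simp add: gls_q_def e r_def)
qed

text \<open>There are only finitely many digits, so their \<open>K\<close>s are uniformly larger than \<open>1\<close>.\<close>

lemma gls_digit_K_bound:
  assumes "gls_valid G"
  obtains c where "c > 1" "\<And>d. d \<in> gls_digits G \<Longrightarrow> digit_K d \<ge> c"
proof
  \<comment> \<open>Inserting \<open>2\<close> only keeps the minimum from being taken over an empty set.\<close>
  let ?Ks = "insert 2 (digit_K ` gls_digits G)"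
  have fin: "finite ?Ks"
    by (simp add: gls_digits_eq finite_gls_edges)
  have "1 < digit_K (digit_of G e)" if "e \<in> gls_edges G" for e
    using gls_q_pos[OF assms that] gls_q_less_1[OF assms that]
    by (simp add: digit_of_def one_less_inverse)
  then show "Min ?Ks > 1"
    using fin by (auto simp: gls_digits_eq)
  show "Min ?Ks \<le> digit_K d" if "d \<in> gls_digits G" for d
    using fin that by (intro Min_le) auto
qed

lemma pull_back_in_unit:
  assumes "gls_valid G" "e \<in> gls_edges G"
    and y: "gls_r G e \<le> y" "y \<le> gls_r G e + gls_q G e"
  shows "pull_back (digit_of G e) y \<in> {0..1}"
proof -
  have "gls_eps G e = 0 \<or> gls_eps G e = 1"
    using assms(1,2) by (auto simp: gls_valid_def gls_edges_def)
  then show ?thesis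
    using y gls_q_pos[OF assms(1,2)] by (auto simp: pull_back_def digit_of_def field_simps)
qed

lemma admissible_edge_in_row:
  assumes "gls_valid G" "j < gls_J G" "y \<in> {0..1}"
  shows "\<exists>e\<in>gls_edges G. fst e = j \<and> pull_back (digit_of G e) y \<in> {0..1}"
proof -
  have "0 < gls_B G j" "gls_r G (j, 0) = 0" "gls_r G (j, gls_B G j) = 1"
    using assms(1,2) by (force simp: gls_valid_def)+
  then obtain k where k: "k < gls_B G j" "y \<in> {gls_r G (j, k)..gls_r G (j, Suc k)}"
    using partition_cover[of "gls_B G j" y "\<lambda>k. gls_r G (j, k)"] assms(3) by auto
  then have "(j, k) \<in> gls_edges G"
    using assms(2) by (simp add: gls_edges_def)
  moreover have "pull_back (digit_of G (j, k)) y \<in> {0..1}"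
    using k by (intro pull_back_in_unit[OF assms(1) calculation]) (auto simp: gls_q_def)
  ultimately show ?thesis
    by force
qed

text \<open>A digit \<open>(s, K, t)\<close> determines its map: \<open>h_e x = t + (-1)^s x / K\<close>.\<close>

lemma gls_h_eq_if_digit_eq:
  assumes "digit_of G e = digit_of G e'"
  shows "gls_h G e = gls_h G e'"
proof -
  have "gls_h G e = (\<lambda>x\<in>{0..1}. digit_t (digit_of G e)
      + (-1) ^ digit_s (digit_of G e) * x / digit_K (digit_of G e))" for e
    by (simp add: gls_h_def digit_of_def divide_inverse algebra_simps)
  then show ?thesis
    using assms by simp
qed

lemma two_admissible_digits:
  assumes "gls_valid G"
    and h: "\<forall>e\<in>gls_edges G. \<forall>e'\<in>gls_edges G. e \<noteq> e' \<longrightarrow> gls_h G e \<noteq> gls_h G e'"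
    and "y \<in> {0..1}"
  shows "\<exists>d\<in>gls_digits G. \<exists>d'\<in>gls_digits G.
    d \<noteq> d' \<and> pull_back d y \<in> {0..1} \<and> pull_back d' y \<in> {0..1}"
proof -
  have "0 < gls_J G" "1 < gls_J G"
    using assms(1) by (auto simp: gls_valid_def)
  then obtain e e' where
    e: "e \<in> gls_edges G" "fst e = 0" "pull_back (digit_of G e) y \<in> {0..1}" and
    e': "e' \<in> gls_edges G" "fst e' = 1" "pull_back (digit_of G e') y \<in> {0..1}"
    using admissible_edge_in_row[OF assms(1) _ assms(3)] by meson
  then have "e \<noteq> e'"
    by auto
  then have "digit_of G e \<noteq> digit_of G e'"
    using h e(1) e'(1) gls_h_eq_if_digit_eq by blast
  then show ?thesis
    using e e' unfolding gls_digits_eq by blast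
qed

section \<open>Uncountably many expansions\<close>

theorem proposition4p1:
  fixes G :: gls_data
    and F :: "nat \<times> nat \<Rightarrow> real ^ 2 \<Rightarrow> real ^ 2"
    and x :: real
  assumes "is_gls_ifs G F"
    and "\<forall>e\<in>gls_edges G. \<forall>e'\<in>gls_edges G. e \<noteq> e' \<longrightarrow> gls_h G e \<noteq> gls_h G e'"
    and "x \<in> {0..1}"
  shows "uncountable {\<omega>. (\<forall>m. \<omega> m \<in> gls_digits G) \<and> gls_expansion \<omega> x}"
proof -
  have valid: "gls_valid G"
    using assms(1) by (simp add: is_gls_ifs_def)
  obtain c where c: "c > 1" "\<And>d. d \<in> gls_digits G \<Longrightarrow> digit_K d \<ge> c"
    using gls_digit_K_bound[OF valid] by blast
  have "{\<omega>. \<forall>m. \<omega> m \<in> gls_digits G \<and> orbit pull_back \<omega> x m \<in> {0..1}}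
      \<subseteq> {\<omega>. (\<forall>m. \<omega> m \<in> gls_digits G) \<and> gls_expansion \<omega> x}"
    using gls_expansion_if_orbit_in_unit[OF c(1)] c(2) by blast
  moreover have "uncountable {\<omega>. \<forall>m. \<omega> m \<in> gls_digits G \<and> orbit pull_back \<omega> x m \<in> {0..1}}"
    using two_admissible_digits[OF valid assms(2)] assms(3) by (rule uncountable_itineraries)
  ultimately show ?thesis
    using countable_subset by blast
qed

end
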